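(* Let $(M_i)_{i\ge 1}$ be an increasing sequence of positive integers with $M_i\to\infty$, let $q_1=2$, $q_{i+1}=q_i^{M_i}$, and let $\phi:[2,\infty)\to(0,\infty)$ be monotone increasing with $\phi(t)\to\infty$. For each $i\ge1$ define $$G_i=\frac{1}{q_i}\big([0,q_i]\cap\mathbb Z\big),\qquad r_i=q_i^{-\phi(q_i)},\qquad E_i=\{x\in[0,1]:\operatorname{dist}(x,G_i)\le r_i\},\qquad E=\bigcap_{i=1}^\infty E_i.$$ Assume that $\phi(q_i)<M_i-1$ for all sufficiently large $i$. Then for all sufficiently large $i$, $$\frac1{q_i}\in E.$$ In particular, $E$ contains the sequence $a_i=\frac1{q_i}$ ($i$ sufficiently large), with $a_i\to0$; moreover $$\frac{a_{i+1}}{a_i}=\frac{1}{q_i^{M_i-1}}\to 0.$$ *)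

theory Defs
  imports "HOL-Analysis.Analysis"
begin

definition grid :: "nat \<Rightarrow> real set" where
  "grid n = (\<lambda>x. x / real n) ` ({0..real n} \<inter> \<int>)"

definition radius :: "(real \<Rightarrow> real) \<Rightarrow> nat \<Rightarrow> real" where
  "radius \<phi> n = real n powr (- \<phi> (real n))"

definition level_set :: "(real \<Rightarrow> real) \<Rightarrow> nat \<Rightarrow> real set" where
  "level_set \<phi> n = {x \<in> {0..1}. infdist x (grid n) \<le> radius \<phi> n}"

text \<open>Sequences are indexed from 1; the value \<open>q 0\<close> plays no role.\<close>

definition limit_set :: "(real \<Rightarrow> real) \<Rightarrow> (nat \<Rightarrow> nat) \<Rightarrow> real set" where
  "limit_set \<phi> q = (\<Inter>i\<in>{1..}. level_set \<phi> (q i))"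

end

theory Submission
  imports Defs
begin

text \<open>Write \<open>x = 1 / q\<^sub>i\<close>. For \<open>j \<ge> i\<close>, \<open>q\<^sub>i\<close> divides \<open>q\<^sub>j\<close>, so \<open>x\<close> is itself a grid point at level \<open>j\<close>.
  For \<open>j < i\<close>, \<open>x\<close> is within \<open>1 / q\<^sub>i\<close> of the grid point \<open>0\<close>, and
  \<open>1 / q\<^sub>i \<le> 1 / q\<^bsub>j+1\<^esub> = q\<^sub>j powr (- M\<^sub>j) \<le> r\<^sub>j\<close> as soon as \<open>\<phi>(q\<^sub>j) \<le> M\<^sub>j\<close>.
  The finitely many \<open>j\<close> not covered by this have fixed positive radii, while \<open>1 / q\<^sub>i\<close> tends to \<open>0\<close>.\<close>

lemma zero_in_grid: "0 \<in> grid n"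
  unfolding grid_def by (rule image_eqI[where x = 0]) auto

text \<open>The numerator over \<open>n\<close> is the cofactor \<open>k\<close> in
  \<open>n = m * k\<close>; it is at most \<open>n\<close> because \<open>n > 0\<close> forces
  \<open>m\<close> to be positive.\<close>

lemma inverse_dvd_in_grid:
  assumes "m dvd n" "n > 0"
  shows "1 / real m \<in> grid n"
proof -
  obtain k where k: "n = m * k" using assms by blast
  have "1 / real m = real k / real n" using k assms by (simp add: field_simps)
  moreover have "real k \<in> {0..real n} \<inter> \<int>" using k assms by simp
  ultimately show ?thesis unfolding grid_def by blast
qed

lemma radius_nonneg: "radius \<phi> n \<ge> 0"
  by (simp add: radius_def)

lemma grid_subset_level_set:
  assumes "x \<in> grid n" "x \<in> {0..1}"
  shows "x \<in> level_set \<phi> n"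
  using assms by (simp add: level_set_def radius_nonneg)

lemma small_in_level_set:
  assumes "0 \<le> x" "x \<le> 1" "x \<le> radius \<phi> n"
  shows "x \<in> level_set \<phi> n"
proof -
  have "infdist x (grid n) \<le> dist x 0" by (rule infdist_le[OF zero_in_grid])
  thus ?thesis using assms by (simp add: level_set_def)
qed

text \<open>For a base at least 1, \<open>powr\<close> increases with its exponent, so the claim
  reduces to \<open>- m \<le> - \<phi> n\<close>. With \<open>n = q j\<close> and
  \<open>m = M j\<close>, the left side is the reciprocal of \<open>q (Suc j)\<close>.\<close>

lemma inverse_power_le_radius:
  assumes "n \<ge> 1" "\<phi> (real n) \<le> real m"
  shows "1 / real (n ^ m) \<le> radius \<phi> n"
proof -
  have "1 / real (n ^ m) = real n powr (- real m)"
    using assms by (simp add: powr_minus powr_realpow divide_inverse)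
  also have "\<dots> \<le> radius \<phi> n"
    unfolding radius_def using assms by (intro powr_mono) auto
  finally show ?thesis .
qed

theorem lemma2p4:
  fixes M q :: "nat \<Rightarrow> nat" and \<phi> :: "real \<Rightarrow> real" and a :: "nat \<Rightarrow> real"
  assumes M_pos: "\<And>i. i \<ge> 1 \<Longrightarrow> M i > 0"
    and M_mono: "mono_on {1..} M"
    and M_lim: "filterlim M at_top sequentially"
    and q_1: "q 1 = 2"
    and q_Suc: "\<And>i. i \<ge> 1 \<Longrightarrow> q (Suc i) = q i ^ M i"
    and phi_pos: "\<And>t. t \<ge> 2 \<Longrightarrow> \<phi> t > 0"
    and phi_mono: "mono_on {2..} \<phi>"
    and phi_lim: "filterlim \<phi> at_top at_top"
    and phi_less: "\<forall>\<^sub>F i in sequentially. \<phi> (real (q i)) < real (M i) - 1"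
    and a_def: "\<And>i. i \<ge> 1 \<Longrightarrow> a i = 1 / real (q i)"
  shows "(\<forall>\<^sub>F i in sequentially. 1 / real (q i) \<in> limit_set \<phi> q)
    \<and> (\<forall>\<^sub>F i in sequentially. a i \<in> limit_set \<phi> q)
    \<and> a \<longlonglongrightarrow> 0
    \<and> (\<forall>i\<ge>1. a (Suc i) / a i = 1 / real (q i) ^ (M i - 1))
    \<and> (\<lambda>i. a (Suc i) / a i) \<longlonglongrightarrow> 0"
proof -
  have q_ge2: "q i \<ge> 2" if "i \<ge> 1" for i
    using that
  proof (induction i rule: dec_induct)
    case (step i)
    have "q i \<le> q i ^ M i" using M_pos[of i] step by (intro self_le_power) auto
    thus ?case using step q_Suc by simp
  qed (use q_1 in simp)
  have q_dvd: "q i dvd q j" if "1 \<le> i" "i \<le> j" for i j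
    using that(2)
  proof (induction j rule: dec_induct)
    case (step j)
    have "q j dvd q j ^ M j" using M_pos[of j] step that by (intro dvd_power) auto
    thus ?case using step q_Suc[of j] that by (auto intro: dvd_trans)
  qed simp
  have q_le: "q i \<le> q j" if "1 \<le> i" "i \<le> j" for i j
    using q_dvd[OF that] q_ge2[of j] that by (intro dvd_imp_le) auto
  \<comment> \<open>This bound transfers the divergence of \<open>M\<close> to the ratios, and
    through them to \<open>q\<close>. It rests on \<open>k + 1 \<le> 2 ^ k\<close> for
    \<open>k = M i - 1\<close>.\<close>
  have ratio_ge: "M i \<le> q i ^ (M i - 1)" if "i \<ge> 1" for i
  proof -
    have "M i \<le> 2 ^ (M i - 1)" using less_exp[of "M i - 1"] by linarith
    also have "\<dots> \<le> q i ^ (M i - 1)" using q_ge2[OF that] by (intro power_mono) auto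
    finally show ?thesis .
  qed
  have ratio_lim: "filterlim (\<lambda>i. q i ^ (M i - 1)) at_top sequentially"
    by (rule filterlim_at_top_mono[OF M_lim])
      (use ratio_ge in \<open>auto intro: eventually_sequentiallyI[of 1]\<close>)
  have ratio: "a (Suc i) / a i = 1 / real (q i) ^ (M i - 1)" if "i \<ge> 1" for i
  proof -
    \<comment> \<open>Positivity of \<open>M i\<close> makes the truncated subtraction exact, so one
      factor \<open>q i\<close> splits off.\<close>
    have "q (Suc i) = q i * q i ^ (M i - 1)"
      using q_Suc[OF that] M_pos[OF that] by (simp flip: power_Suc)
    then show ?thesis using q_ge2[OF that] that by (simp add: a_def)
  qed
  have "q i ^ (M i - 1) \<le> q (Suc i)" if "i \<ge> 1" for i
    using q_ge2[OF that] q_Suc[OF that] by (auto intro: power_increasing)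
  then have "filterlim (\<lambda>i. q (Suc i)) at_top sequentially"
    by (intro filterlim_at_top_mono[OF ratio_lim] eventually_sequentiallyI[of 1])
  then have "filterlim q at_top sequentially"
    by (simp add: filterlim_sequentially_Suc)
  then have inv_q_lim: "(\<lambda>i. 1 / real (q i)) \<longlonglongrightarrow> 0"
    by (intro tendsto_divide_0[OF tendsto_const] filterlim_at_top_imp_at_infinity
        filterlim_compose[OF filterlim_real_sequentially])
  \<comment> \<open>The value \<open>a 0\<close> is unconstrained, so limits of \<open>a\<close> are
    obtained from eventual equality.\<close>
  have a_eq: "\<forall>\<^sub>F i in sequentially. a i = 1 / real (q i)"
    using a_def by (intro eventually_sequentiallyI[of 1])
  have a_lim: "a \<longlonglongrightarrow> 0"
    using inv_q_lim tendsto_cong[OF a_eq] by simp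
  have "(\<lambda>i. 1 / real (q i ^ (M i - 1))) \<longlonglongrightarrow> 0"
    by (intro tendsto_divide_0[OF tendsto_const] filterlim_at_top_imp_at_infinity
        filterlim_compose[OF filterlim_real_sequentially] ratio_lim)
  moreover have "\<forall>\<^sub>F i in sequentially. a (Suc i) / a i = 1 / real (q i ^ (M i - 1))"
    using ratio by (intro eventually_sequentiallyI[of 1]) simp
  ultimately have quot_lim: "(\<lambda>i. a (Suc i) / a i) \<longlonglongrightarrow> 0"
    using tendsto_cong by fastforce
  obtain N where N: "\<And>j. j \<ge> N \<Longrightarrow> \<phi> (real (q j)) < real (M j) - 1"
    using phi_less unfolding eventually_sequentially by blast
  have "\<forall>\<^sub>F i in sequentially. \<forall>j\<in>{1..<N}. 1 / real (q i) < radius \<phi> (q j)"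
  proof (rule eventually_ball_finite)
    show "\<forall>j\<in>{1..<N}. \<forall>\<^sub>F i in sequentially. 1 / real (q i) < radius \<phi> (q j)"
    proof
      fix j assume "j \<in> {1..<N}"
      then have "radius \<phi> (q j) > 0" using q_ge2[of j] by (simp add: radius_def)
      then show "\<forall>\<^sub>F i in sequentially. 1 / real (q i) < radius \<phi> (q j)"
        by (rule order_tendstoD(2)[OF inv_q_lim])
    qed
  qed simp
  then have mem: "\<forall>\<^sub>F i in sequentially. 1 / real (q i) \<in> limit_set \<phi> q"
    using eventually_ge_at_top[of 1]
  proof eventually_elim
    case (elim i)
    have x: "0 \<le> 1 / real (q i)" "1 / real (q i) \<le> 1"
      using q_ge2[of i] elim by auto
    have "1 / real (q i) \<in> level_set \<phi> (q j)" if j: "j \<ge> 1" for j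
    proof (cases "i \<le> j")
      case True
      then show ?thesis
        using x q_dvd[of i j] q_ge2[OF j] elim
        by (intro grid_subset_level_set inverse_dvd_in_grid) auto
    next
      case False
      have "1 / real (q i) \<le> radius \<phi> (q j)"
      proof (cases "j < N")
        case True
        then show ?thesis using elim j by (simp add: less_imp_le)
      next
        case large: False
        \<comment> \<open>Here \<open>j < i\<close> means \<open>Suc j \<le> i\<close>, and the left
          side is \<open>q (Suc j)\<close>, so monotonicity of \<open>q\<close> applies.\<close>
        have "q j ^ M j \<le> q i"
          using q_le[of "Suc j" i] q_Suc[OF j] False by simp
        moreover have "0 < q j ^ M j" using q_ge2[OF j] by simp
        ultimately have "1 / real (q i) \<le> 1 / real (q j ^ M j)"
          by (intro frac_le) (simp_all del: of_nat_power)
        also have "\<dots> \<le> radius \<phi> (q j)"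
          using N[of j] large q_ge2[OF j] by (intro inverse_power_le_radius) auto
        finally show ?thesis .
      qed
      then show ?thesis using x by (intro small_in_level_set)
    qed
    then show ?case by (simp add: limit_set_def)
  qed
  have "\<forall>\<^sub>F i in sequentially. a i \<in> limit_set \<phi> q"
    using mem a_eq by eventually_elim simp
  then show ?thesis using mem a_lim ratio quot_lim by blast
qed

end
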